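(* Let $\mathcal{H}$ be a real Hilbert space and let $f:\mathcal{H}\to\mathbb{R}$ be convex, of class $\mathcal{C}^1$, with $\nabla f$ Lipschitz continuous on bounded subsets of $\mathcal{H}$, and with $S:=\operatorname{argmin}_{\mathcal{H}} f\neq\emptyset$. Let $x^*$ be the element of minimum norm of $S$. Let $0<r<1$, $\alpha>1$, and $t_0>0$. Let $x:[t_0,+\infty[\to\mathcal{H}$ be a solution trajectory of $$\ddot x(t)+\left(\frac{\alpha}{t}+\frac{2^r(\alpha-1)^{r-1}}{t^{2r-1}}\right)\dot x(t)+\nabla f\left(x(t)+\frac{t}{\alpha-1}\dot x(t)\right)+\frac{2^r(\alpha-1)^r}{t^{2r}}\,x(t)=0 .$$ Then the following properties are satisfied: (i) $f(x(t))-\min_{\mathcal{H}} f=\mathcal{O}\left(\frac{1}{t^{\alpha-1}}+\frac{1}{t^{2r}}\right)$ as $t\to+\infty$; (ii) $x(t)$ converges strongly (in norm) to the minimum norm solution $x^*$ as $t\to+\infty$; (iii) $\|\nabla f(x(t))\|^2=\mathcal{O}\left(\frac{1}{t^{\alpha-1}}+\frac{1}{t^{2r}}\right)$ as $t\to+\infty$.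
   Context: A solution trajectory is a function of class $\mathcal{C}^2$ on $[t_0,+\infty[$ satisfying the differential equation for all $t\ge t_0$ (with arbitrary initial data). $\mathcal{O}(g(t))$ means bounded by a constant times $g(t)$ for $t$ large, where the constant may depend on the trajectory. *)

theory Defs
  imports "HOL-Analysis.Analysis" "HOL-Library.Landau_Symbols"
begin

definition argmin :: "('a \<Rightarrow> real) \<Rightarrow> 'a set" where
  "argmin f = {y. is_arg_min f (\<lambda>_. True) y}"

text \<open>The element of minimum norm of a set; for a nonempty closed convex subset of a Hilbert
  space it exists and is unique, so the choice made by \<^const>\<open>arg_min\<close> is immaterial there.\<close>

definition min_norm_element :: "'a::real_normed_vector set \<Rightarrow> 'a" where
  "min_norm_element S = (ARG_MIN norm y. y \<in> S)"

text \<open>Derivatives are taken within \<open>{t0..}\<close>, hence one-sided at \<open>t0\<close>; values of \<open>x\<close> to the left of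
  \<open>t0\<close> are irrelevant.\<close>

definition C2_with_derivs ::
  "real \<Rightarrow> (real \<Rightarrow> 'a::real_normed_vector) \<Rightarrow> (real \<Rightarrow> 'a) \<Rightarrow> (real \<Rightarrow> 'a) \<Rightarrow> bool" where
  "C2_with_derivs t0 x x' x'' \<longleftrightarrow>
     (\<forall>t\<ge>t0. (x has_vector_derivative x' t) (at t within {t0..})) \<and>
     (\<forall>t\<ge>t0. (x' has_vector_derivative x'' t) (at t within {t0..})) \<and>
     continuous_on {t0..} x''"

end

theory Submission
  imports Defs
begin

text \<open>
  The point \<open>y t = x t + (t / (\<alpha> - 1)) *\<^sub>R x' t\<close> turns the second order equation into a first order
  one. Differentiating \<open>y\<close> and inserting the equation gives
  \<open>y' = - (t / (\<alpha> - 1)) *\<^sub>R (gradf y + \<epsilon>(t) *\<^sub>R y)\<close> with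
  \<open>\<epsilon>(t) = 2 powr r * (\<alpha> - 1) powr r / t powr (2 * r)\<close>, a gradient flow of the regularised functions \<open>f + (\<epsilon>/2) \<parallel>\<cdot>\<parallel>\<^sup>2\<close> run at speed \<open>t / (\<alpha> - 1)\<close>; conversely
  \<open>x' = ((\<alpha> - 1) / t) *\<^sub>R (y - x)\<close>, so that \<open>x\<close> is a weighted average of \<open>y\<close>.

  Let \<open>z(\<epsilon>)\<close> be the minimiser of the regularised function and \<open>M(\<epsilon>)\<close> its minimal value. As \<open>\<epsilon>\<close>
  decreases to \<open>0\<close>, the norm of \<open>z(\<epsilon>)\<close> increases and stays below the norm of every minimiser of
  \<open>f\<close>, and a monotonicity estimate bounds distances on this curve by increments of the squared norm.
  Hence \<open>z(\<epsilon>)\<close> is Cauchy and its limit is the minimiser of \<open>f\<close> of least norm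
  (\<open>reg_argmin_tendsto_argmin\<close>). The curve need not be
  differentiable, but \<open>M\<close> is, with \<open>M'(\<epsilon>) = \<parallel>z(\<epsilon>)\<parallel>\<^sup>2 / 2\<close> (\<open>reg_min_has_derivative\<close>).

  The excess \<open>W(t)\<close> of the regularised value at \<open>y t\<close> over \<open>M(\<epsilon>(t))\<close> is therefore differentiable.
  Strong convexity makes it contract at a rate proportional to \<open>t * \<epsilon>(t)\<close>, and the drift of \<open>\<epsilon>\<close>,
  up to a part absorbed by the contraction, feeds it at rate \<open>O(t\<^sup>-\<^sup>3)\<close> only; since \<open>r < 1\<close> the contraction wins and
  \<open>W(t) = O(t powr (2 * r - 4))\<close> (\<open>energy_bound\<close>). Consequently \<open>y\<close> follows \<open>z(\<epsilon>(t))\<close>, and both \<open>y\<close>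
  and its average \<open>x\<close> tend to the minimiser of least norm.

  For the values, \<open>f (y t) - min f\<close> exceeds \<open>f (z(\<epsilon>(t))) - min f\<close> by \<open>O(t\<^sup>-\<^sup>2)\<close> only. Bounding the
  latter pointwise by a multiple of \<open>\<epsilon>(t)\<close> and integrating would produce a logarithm when
  \<open>\<alpha> - 1 = 2 * r\<close>. Instead, the ratio \<open>(M(\<epsilon>) - min f) / \<epsilon>\<close> is bounded, and its derivative along
  \<open>\<epsilon>(t)\<close> is exactly a multiple of \<open>t powr (2 * r - 1) * (f (z(\<epsilon>(t))) - min f)\<close>
  (\<open>gap_ratio_deriv\<close>). Against this integrable weight the averaging inequality integrates to the
  stated rate for all \<open>\<alpha> > 1\<close> at once (\<open>averaged_value_rate\<close>). The rate for the gradient follows from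
  that of the values, because on a bounded set the squared gradient norm of a convex function with
  Lipschitz gradient is controlled by the excess of the value over the minimum.
\<close>


section \<open>Calculus and Hilbert space preliminaries\<close>

lemma gradient_chain_rule:
  fixes f :: "'a::real_inner \<Rightarrow> real"
  assumes "GDERIV f (y t) :> g" and "(y has_vector_derivative v) (at t)"
  shows "((\<lambda>t. f (y t)) has_real_derivative (g \<bullet> v)) (at t)"
proof -
  have "((\<lambda>t. f (y t)) has_derivative (\<lambda>h. (h *\<^sub>R v) \<bullet> g)) (at t)"
    using has_derivative_compose[of y "\<lambda>h. h *\<^sub>R v" t UNIV f "\<lambda>h. h \<bullet> g"] assms
    unfolding gderiv_def has_vector_derivative_def by simp
  then show ?thesis
    unfolding has_field_derivative_def
    by (rule has_derivative_subst) (auto simp: inner_commute fun_eq_iff)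
qed

lemma has_real_derivative_norm_square:
  fixes y :: "real \<Rightarrow> 'a::real_inner"
  assumes "(y has_vector_derivative v) (at t)"
  shows "((\<lambda>t. (norm (y t))\<^sup>2) has_real_derivative 2 * (y t \<bullet> v)) (at t)"
proof -
  have "((\<lambda>t. y t \<bullet> y t) has_derivative (\<lambda>h. y t \<bullet> (h *\<^sub>R v) + (h *\<^sub>R v) \<bullet> y t)) (at t)"
    using assms unfolding has_vector_derivative_def by (intro derivative_eq_intros) auto
  then show ?thesis
    unfolding has_field_derivative_def power2_norm_eq_inner
    by (rule has_derivative_subst) (auto simp: inner_commute fun_eq_iff)
qed

lemma norm_midpoint_square:
  fixes a b :: "'a::real_inner"
  shows "(norm ((1/2) *\<^sub>R (a + b)))\<^sup>2 = ((norm a)\<^sup>2 + (norm b)\<^sup>2) / 2 - (norm (a - b))\<^sup>2 / 4"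
  by (simp add: power2_norm_eq_inner inner_add_left inner_add_right inner_diff_left inner_diff_right
      inner_commute field_simps)

lemma norm_add_scaleR_square:
  fixes a b :: "'a::real_inner"
  shows "(norm (a + s *\<^sub>R b))\<^sup>2 = (norm a)\<^sup>2 + 2 * s * (a \<bullet> b) + s\<^sup>2 * (norm b)\<^sup>2"
  unfolding power2_norm_eq_inner
  by (simp add: power2_eq_square inner_add_left inner_add_right inner_commute algebra_simps)

lemma deriv_le_imp_increment_le:
  fixes F G :: "real \<Rightarrow> real"
  assumes "a \<le> b"
    and "\<And>t. a \<le> t \<Longrightarrow> t \<le> b \<Longrightarrow> (F has_real_derivative F' t) (at t)"
    and "\<And>t. a \<le> t \<Longrightarrow> t \<le> b \<Longrightarrow> (G has_real_derivative G' t) (at t)"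
    and "\<And>t. a \<le> t \<Longrightarrow> t \<le> b \<Longrightarrow> F' t \<le> G' t"
  shows "F b - F a \<le> G b - G a"
proof -
  have "F b - G b \<le> F a - G a"
  proof (rule DERIV_nonpos_imp_nonincreasing[OF assms(1)])
    fix t assume "a \<le> t" "t \<le> b"
    then show "\<exists>y. ((\<lambda>t. F t - G t) has_real_derivative y) (at t) \<and> y \<le> 0"
      using assms(2-4) by (intro exI[of _ "F' t - G' t"]) (auto intro!: DERIV_diff)
  qed
  then show ?thesis by simp
qed

text \<open>Restriction to the line through \<open>a\<close> and \<open>b\<close> reduces this to the tangent inequality for
  convex functions of one real variable.\<close>
lemma convex_gradient_inequality:
  fixes f :: "'a::real_inner \<Rightarrow> real"
  assumes convex: "convex_on UNIV f" and grad: "GDERIV f a :> g"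
  shows "f b \<ge> f a + g \<bullet> (b - a)"
proof -
  let ?l = "\<lambda>s::real. a + s *\<^sub>R (b - a)"
  have "convex_on UNIV (\<lambda>s. f (?l s))"
  proof (rule convex_onI)
    fix t u v :: real assume "0 < t" "t < 1"
    moreover have "?l ((1 - t) *\<^sub>R u + t *\<^sub>R v) = (1 - t) *\<^sub>R ?l u + t *\<^sub>R ?l v"
      by (simp add: algebra_simps)
    ultimately show "f (?l ((1 - t) *\<^sub>R u + t *\<^sub>R v)) \<le> (1 - t) * f (?l u) + t * f (?l v)"
      using convex_onD[OF convex, of t "?l u" "?l v"] by simp
  qed simp
  moreover have "((\<lambda>s. f (?l s)) has_real_derivative (g \<bullet> (b - a))) (at 0)"
    by (rule gradient_chain_rule) (auto intro!: derivative_eq_intros simp: grad)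
  ultimately show ?thesis
    using convex_on_imp_above_tangent[of UNIV "\<lambda>s. f (?l s)" 0 1 "g \<bullet> (b - a)"] by simp
qed

lemma GDERIV_minimum_zero:
  fixes f :: "'a::real_inner \<Rightarrow> real"
  assumes "GDERIV f p :> g" and "\<And>w. f p \<le> f w"
  shows "g = 0"
proof -
  have "(\<lambda>h. h \<bullet> g) = (\<lambda>h. 0)"
    using assms unfolding gderiv_def by (intro differential_zero_maxmin[of p UNIV f]) auto
  then have "g \<bullet> g = 0" by meson
  then show ?thesis by simp
qed

text \<open>A quantity that is pulled towards levels below \<open>C\<close> at a nonnegative rate \<open>a\<close> cannot leave the
  region below its initial value and \<open>C\<close>; the antiderivative \<open>A\<close> of the rate serves as the exponent
  of an integrating factor.\<close>
lemma relaxation_bound: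
  fixes P A :: "real \<Rightarrow> real"
  assumes "T \<le> t"
    and P: "\<And>s. T \<le> s \<Longrightarrow> (P has_real_derivative P' s) (at s)"
    and A: "\<And>s. T \<le> s \<Longrightarrow> (A has_real_derivative a s) (at s)"
    and a: "\<And>s. T \<le> s \<Longrightarrow> 0 \<le> a s"
    and le: "\<And>s. T \<le> s \<Longrightarrow> P' s \<le> a s * (C - P s)"
  shows "P t \<le> max (P T) C"
proof -
  have "(P t - C) * exp (A t) \<le> (P T - C) * exp (A T)"
  proof (rule DERIV_nonpos_imp_nonincreasing[OF \<open>T \<le> t\<close>])
    fix s assume s: "T \<le> s" "s \<le> t"
    have "((\<lambda>s. (P s - C) * exp (A s)) has_real_derivative (P' s - a s * (C - P s)) * exp (A s)) (at s)"
      by (rule derivative_eq_intros P[OF s(1)] A[OF s(1)] refl)+ (simp add: algebra_simps)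
    moreover have "(P' s - a s * (C - P s)) * exp (A s) \<le> 0"
      using le[OF s(1)] by (simp add: mult_nonpos_nonneg)
    ultimately show "\<exists>y. ((\<lambda>s. (P s - C) * exp (A s)) has_real_derivative y) (at s) \<and> y \<le> 0"
      by blast
  qed
  then have decay: "P t - C \<le> (P T - C) * exp (A T - A t)"
    by (simp add: exp_diff field_simps)
  have "A T \<le> A t"
    by (rule DERIV_nonneg_imp_nondecreasing[OF \<open>T \<le> t\<close>]) (use A a in blast)
  then have exp_le: "exp (A T - A t) \<le> 1" by simp
  show ?thesis
  proof (cases "P T \<le> C")
    case True
    then have "(P T - C) * exp (A T - A t) \<le> 0" by (simp add: mult_nonpos_nonneg)
    with decay show ?thesis by simp
  next
    case False
    then have "(P T - C) * exp (A T - A t) \<le> (P T - C) * 1"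
      using exp_le by (intro mult_left_mono) auto
    with decay show ?thesis by simp
  qed
qed

text \<open>The hypothesis says that \<open>t powr a *\<^sub>R x t\<close> has derivative \<open>(a * t powr (a - 1)) *\<^sub>R y t\<close>, so
  \<open>x\<close> is the average of \<open>y\<close> with weight \<open>a * t powr (a - 1)\<close>, whose total mass is infinite: the past
  is forgotten and the limit of \<open>y\<close> is inherited. The mean value inequality replaces the integral.\<close>
lemma weighted_average_tendsto:
  fixes x y :: "real \<Rightarrow> 'a::real_normed_vector"
  assumes a: "a > 0" and T0: "T0 > 0"
    and x: "\<And>t. t \<ge> T0 \<Longrightarrow> (x has_vector_derivative (a / t) *\<^sub>R (y t - x t)) (at t)"
    and y: "(y \<longlongrightarrow> l) at_top"
  shows "(x \<longlongrightarrow> l) at_top"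
proof (rule tendstoI)
  fix d :: real assume d: "d > 0"
  define u where "u t = t powr a *\<^sub>R (x t - l)" for t
  have u: "(u has_vector_derivative (a * t powr (a - 1)) *\<^sub>R (y t - l)) (at t)" if "t \<ge> T0" for t
  proof -
    have t: "t > 0" using that T0 by simp
    have "(u has_vector_derivative t powr a *\<^sub>R ((a / t) *\<^sub>R (y t - x t) - 0)
        + (a * t powr (a - 1)) *\<^sub>R (x t - l)) (at t)"
      unfolding u_def using t
      by (intro has_vector_derivative_scaleR has_vector_derivative_diff x that has_vector_derivative_const
          has_real_derivative_powr)
    moreover have "t powr a * (a / t) = a * t powr (a - 1)"
      using t by (simp add: powr_diff)
    ultimately show ?thesis by (simp add: scaleR_diff_right)
  qed
  have "\<forall>\<^sub>F t in at_top. dist (y t) l < d / 2" using tendstoD[OF y, of "d/2"] d by simp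
  then obtain T1 where T1: "\<And>t. t \<ge> T1 \<Longrightarrow> norm (y t - l) < d / 2"
    by (auto simp: eventually_at_top_linorder dist_norm)
  define T where "T = max T0 T1"
  have T: "T > 0" using T0 unfolding T_def by simp
  have "((\<lambda>t. norm (u T) / t powr a) \<longlongrightarrow> 0) at_top"
    by (intro tendsto_divide_0[OF tendsto_const] filterlim_at_top_imp_at_infinity real_powr_at_top a)
  then have "\<forall>\<^sub>F t in at_top. norm (u T) / t powr a < d / 2"
    using d by (intro order_tendstoD) auto
  then show "\<forall>\<^sub>F t in at_top. dist (x t) l < d"
    using eventually_gt_at_top[of T]
  proof eventually_elim
    fix t assume lt: "norm (u T) / t powr a < d / 2" and t: "T < t"
    have t0: "t > 0" using t T by simp
    have "norm (u t - u T) \<le> d / 2 * t powr a - d / 2 * T powr a"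
    proof (rule differentiable_bound_general[OF t])
      have der: "((\<lambda>s. d / 2 * s powr a) has_vector_derivative d / 2 * (a * s powr (a - 1))) (at s)" 
        if "T \<le> s" for s
        unfolding has_real_derivative_iff_has_vector_derivative[symmetric]
        by (intro DERIV_cmult has_real_derivative_powr) (use that T in auto)
      show "((\<lambda>s. d / 2 * s powr a) has_vector_derivative d / 2 * (a * s powr (a - 1))) (at s)" 
        if "T < s" for s using der that by simp
      show "(u has_vector_derivative (a * s powr (a - 1)) *\<^sub>R (y s - l)) (at s)" if "T < s" for s
        using u[of s] that by (simp add: T_def)
      show "continuous_on {T..t} u"
        using u by (intro continuous_at_imp_continuous_on ballI has_vector_derivative_continuous)
          (auto simp: T_def)
      show "continuous_on {T..t} (\<lambda>s. d / 2 * s powr a)"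
        using der by (intro continuous_at_imp_continuous_on ballI has_vector_derivative_continuous) auto
      show "norm ((a * s powr (a - 1)) *\<^sub>R (y s - l)) \<le> d / 2 * (a * s powr (a - 1))" if "T < s" for s
      proof -
        have "norm ((a * s powr (a - 1)) *\<^sub>R (y s - l)) = (a * s powr (a - 1)) * norm (y s - l)"
          using a by simp
        also have "\<dots> \<le> (a * s powr (a - 1)) * (d / 2)"
          using T1[of s] that a by (intro mult_left_mono) (auto simp: T_def)
        finally show ?thesis by (simp only: mult.commute)
      qed
    qed
    also have "\<dots> \<le> d / 2 * t powr a" using d by simp
    finally have "norm (u t) \<le> norm (u T) + d / 2 * t powr a"
      using norm_triangle_sub[of "u t" "u T"] by simp
    then have "t powr a * norm (x t - l) \<le> norm (u T) + d / 2 * t powr a"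
      by (simp add: u_def)
    then have "norm (x t - l) \<le> norm (u T) / t powr a + d / 2"
      using t0 by (simp add: field_simps)
    with lt show "dist (x t) l < d" unfolding dist_norm by linarith
  qed
qed

section \<open>Convex functions with a gradient and a minimiser\<close>

locale convex_gradient =
  fixes f :: "'a::{real_inner, complete_space} \<Rightarrow> real" and gradf :: "'a \<Rightarrow> 'a"
  assumes convex: "convex_on UNIV f"
    and grad: "\<And>y. GDERIV f y :> gradf y"
    and nonempty: "argmin f \<noteq> {}"
begin

abbreviation fmin :: real where "fmin \<equiv> (INF y. f y)"

lemma argmin_iff: "p \<in> argmin f \<longleftrightarrow> (\<forall>w. f p \<le> f w)"
  by (auto simp: argmin_def is_arg_min_linorder)

lemma argmin_value: "p \<in> argmin f \<Longrightarrow> f p = fmin"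
  unfolding argmin_iff by (intro antisym cINF_greatest cINF_lower) (auto intro!: bdd_belowI)

lemma fmin_le: "fmin \<le> f w"
  using nonempty argmin_value argmin_iff by (metis ex_in_conv)

lemma argmin_iff_value: "p \<in> argmin f \<longleftrightarrow> f p \<le> fmin"
  using argmin_value fmin_le argmin_iff by (metis order.refl order.trans)

lemma gradient_inequality: "f a + gradf a \<bullet> (b - a) \<le> f b"
  using convex_gradient_inequality[OF convex grad] .

lemma gradient_monotone: "0 \<le> (gradf a - gradf b) \<bullet> (a - b)"
  using gradient_inequality[of a b] gradient_inequality[of b a]
  by (simp add: inner_diff_left inner_diff_right)

text \<open>One gradient step from \<open>w\<close> cannot go below the minimum. The step length \<open>1 / (2 * L)\<close>
  is short enough to stay in the ball on which \<open>gradf\<close> is Lipschitz, and there convexity at the end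
  point of the step bounds the decrease from below without integrating along the step.\<close>
lemma gradient_square_le:
  assumes p: "p \<in> argmin f" and L: "L-lipschitz_on (cball p 2) gradf" "L > 0"
    and w: "w \<in> cball p 1"
  shows "(norm (gradf w))\<^sup>2 \<le> 4 * L * (f w - fmin)"
proof -
  let ?g = "gradf w"
  define v where "v = w - (1 / (2 * L)) *\<^sub>R ?g"
  have "gradf p = 0"
    by (rule GDERIV_minimum_zero[OF grad]) (use p argmin_iff in auto)
  then have "norm ?g \<le> L * norm (w - p)"
    using lipschitz_onD[OF L(1), of w p] w by (simp add: dist_norm norm_minus_commute)
  also have "\<dots> \<le> L * 1" using w L(2) by (intro mult_left_mono) (auto simp: dist_norm norm_minus_commute)
  finally have "norm ((1 / (2 * L)) *\<^sub>R ?g) \<le> 1" using L(2) by (simp add: field_simps)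
  then have "v \<in> cball p 2"
    using w norm_triangle_ineq4[of "w - p" "(1 / (2 * L)) *\<^sub>R ?g"]
    unfolding v_def by (simp add: dist_norm norm_minus_commute algebra_simps)
  then have lip: "norm (gradf v - ?g) \<le> L * norm (v - w)"
    using lipschitz_onD[OF L(1), of v w] w by (simp add: dist_norm)
  have vw: "v - w = - (1 / (2 * L)) *\<^sub>R ?g" unfolding v_def by simp
  have "(gradf v - ?g) \<bullet> (v - w) \<le> norm (gradf v - ?g) * norm (v - w)"
    by (rule norm_cauchy_schwarz)
  also have "\<dots> \<le> L * norm (v - w) * norm (v - w)" using lip by (intro mult_right_mono) auto
  also have "\<dots> = (norm ?g)\<^sup>2 / (4 * L)"
    unfolding vw using L(2) by (simp add: power2_eq_square field_simps)
  finally have 1: "(gradf v - ?g) \<bullet> (v - w) \<le> (norm ?g)\<^sup>2 / (4 * L)" .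
  have 2: "?g \<bullet> (v - w) = - (norm ?g)\<^sup>2 / (2 * L)"
    unfolding vw by (simp add: power2_norm_eq_inner)
  have "fmin - f w \<le> gradf v \<bullet> (v - w)"
    using gradient_inequality[of v w] fmin_le[of v] by (simp add: inner_diff_right)
  also have "\<dots> = (gradf v - ?g) \<bullet> (v - w) + ?g \<bullet> (v - w)" by (simp add: inner_diff_left)
  also have "\<dots> \<le> - (norm ?g)\<^sup>2 / (4 * L)" using 1 2 L(2) by (simp add: field_simps)
  finally show ?thesis using L(2) by (simp add: field_simps)
qed

lemma continuous_f: "continuous_on A f"
proof -
  have "isCont f y" for y
    using grad[of y] unfolding gderiv_def by (rule has_derivative_continuous)
  then show ?thesis by (simp add: continuous_at_imp_continuous_on)
qed

section \<open>The Tikhonov curve\<close>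

abbreviation reg :: "real \<Rightarrow> 'a \<Rightarrow> real" where
  "reg e w \<equiv> f w + e / 2 * (norm w)\<^sup>2"

text \<open>Strong convexity of the regularised function: expanding the square makes the quadratic term
  exact.\<close>
lemma reg_gradient_inequality:
  "reg e a + (gradf a + e *\<^sub>R a) \<bullet> (b - a) + e / 2 * (norm (b - a))\<^sup>2 \<le> reg e b"
proof -
  have "(norm b)\<^sup>2 = (norm a)\<^sup>2 + 2 * (a \<bullet> (b - a)) + (norm (b - a))\<^sup>2"
    by (simp add: power2_norm_eq_inner algebra_simps inner_commute)
  then have "e / 2 * (norm b)\<^sup>2 = e / 2 * (norm a)\<^sup>2 + e * (a \<bullet> (b - a)) + e / 2 * (norm (b - a))\<^sup>2"
    by (simp only:) (simp add: distrib_left)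
  then show ?thesis
    using gradient_inequality[of a b] by (simp add: inner_add_left add_divide_distrib)
qed

lemma reg_midpoint:
  "reg e ((1/2) *\<^sub>R (a + b)) \<le> (reg e a + reg e b) / 2 - e / 8 * (norm (a - b))\<^sup>2"
proof -
  have "f ((1/2) *\<^sub>R (a + b)) \<le> (f a + f b) / 2"
    using convex_onD[OF convex, of "1/2" a b] by (simp add: algebra_simps)
  moreover have "e / 2 * (norm ((1/2) *\<^sub>R (a + b)))\<^sup>2
      = (e / 2 * (norm a)\<^sup>2 + e / 2 * (norm b)\<^sup>2) / 2 - e / 8 * (norm (a - b))\<^sup>2"
    unfolding norm_midpoint_square by (simp add: field_simps)
  ultimately show ?thesis by (simp add: field_simps)
qed

text \<open>By the quantitative midpoint inequality every minimising sequence is a Cauchy sequence.\<close>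
lemma reg_minimiser_exists:
  assumes e: "e > 0"
  obtains p where "\<And>w. reg e p \<le> reg e w"
proof -
  define I where "I = (INF w. reg e w)"
  have ge: "fmin \<le> reg e w" for w
    using fmin_le[of w] e by (meson add_increasing2 less_imp_le mult_nonneg_nonneg half_gt_zero zero_le_power2)
  then have bdd: "bdd_below (range (reg e))" by (auto intro!: bdd_belowI)
  then have I_le: "I \<le> reg e w" for w unfolding I_def by (intro cINF_lower) auto
  have "\<exists>w. reg e w < I + 1 / real (Suc n)" for n
    using cINF_less_iff[of UNIV "reg e" "I + 1 / real (Suc n)"] bdd unfolding I_def by auto
  then obtain a where a: "\<And>n. reg e (a n) < I + 1 / real (Suc n)" by metis
  have close: "(norm (a i - a j))\<^sup>2 \<le> 8 / e * (1 / real (Suc N))" if "N \<le> i" "N \<le> j" for N i j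
  proof -
    have "1 / real (Suc i) \<le> 1 / real (Suc N)" "1 / real (Suc j) \<le> 1 / real (Suc N)"
      using that by (auto intro!: divide_left_mono)
    then have "reg e (a i) \<le> I + 1 / real (Suc N)" "reg e (a j) \<le> I + 1 / real (Suc N)"
      using a[of i] a[of j] by linarith+
    then have "(reg e (a i) + reg e (a j)) / 2 \<le> I + 1 / real (Suc N)" by argo
    then have "e / 8 * (norm (a i - a j))\<^sup>2 \<le> 1 / real (Suc N)"
      using order.trans[OF I_le reg_midpoint[where e=e and a="a i" and b="a j"]] by argo
    then have "8 / e * (e / 8 * (norm (a i - a j))\<^sup>2) \<le> 8 / e * (1 / real (Suc N))"
      using e by (intro mult_left_mono) auto
    then show ?thesis using e by simp
  qed
  have "Cauchy a"
  proof (rule metric_CauchyI)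
    fix d :: real assume d: "d > 0"
    obtain N :: nat where "inverse (real (Suc N)) < d\<^sup>2 * e / 8"
      using reals_Archimedean[of "d\<^sup>2 * e / 8"] d e by auto
    then have "8 / e * inverse (real (Suc N)) < 8 / e * (d\<^sup>2 * e / 8)"
      using e by (intro mult_strict_left_mono) auto
    then have N: "8 / e * (1 / real (Suc N)) < d\<^sup>2"
      using e by (simp only: inverse_eq_divide) simp
    have "dist (a i) (a j) < d" if "N \<le> i" "N \<le> j" for i j
      unfolding dist_norm by (rule power2_less_imp_less) (use close[OF that] N d in linarith)+
    then show "\<exists>M. \<forall>m\<ge>M. \<forall>n\<ge>M. dist (a m) (a n) < d" by blast
  qed
  then obtain p where p: "a \<longlonglongrightarrow> p" by (auto simp: Cauchy_convergent_iff convergent_def)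
  have "(\<lambda>n. reg e (a n)) \<longlonglongrightarrow> reg e p"
    by (intro tendsto_intros continuous_on_tendsto_compose[OF continuous_f[of UNIV]] p) auto
  moreover have "(\<lambda>n. I + 1 / real (Suc n)) \<longlonglongrightarrow> I + 0"
    using LIMSEQ_Suc[OF lim_1_over_n] by (intro tendsto_intros) auto
  ultimately have "reg e p \<le> I + 0"
    by (rule LIMSEQ_le) (use a in \<open>auto intro: less_imp_le\<close>)
  then have "reg e p \<le> reg e w" for w using I_le[of w] by simp
  then show ?thesis using that by blast
qed

definition reg_argmin :: "real \<Rightarrow> 'a" where
  "reg_argmin e = (SOME p. \<forall>w. reg e p \<le> reg e w)"

definition reg_min :: "real \<Rightarrow> real" where
  "reg_min e = reg e (reg_argmin e)"

lemma reg_min_le: "e > 0 \<Longrightarrow> reg_min e \<le> reg e w"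
  unfolding reg_argmin_def reg_min_def by (rule someI2_ex) (use reg_minimiser_exists in blast)+

lemma reg_argmin_stationary:
  assumes "e > 0"
  shows "gradf (reg_argmin e) + e *\<^sub>R reg_argmin e = 0"
proof -
  have "GDERIV (reg e) (reg_argmin e) :> gradf (reg_argmin e) + e *\<^sub>R reg_argmin e"
    unfolding gderiv_def power2_norm_eq_inner
    by (rule derivative_eq_intros grad[unfolded gderiv_def] refl)+
       (auto simp: fun_eq_iff inner_add_right inner_commute)
  then show ?thesis
    by (rule GDERIV_minimum_zero) (use reg_min_le[OF assms] in \<open>auto simp: reg_min_def\<close>)
qed

lemma reg_growth:
  assumes "e > 0"
  shows "e / 2 * (norm (w - reg_argmin e))\<^sup>2 \<le> reg e w - reg_min e"
  using reg_gradient_inequality[where e="e" and a="reg_argmin e" and b="w"] reg_argmin_stationary[OF assms] unfolding reg_min_def by simp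

text \<open>The Polyak-Lojasiewicz inequality for a strongly convex function: minimise the quadratic lower
  bound of \<open>reg_gradient_inequality\<close> over the displacement by completing the square.\<close>
lemma reg_gradient_dominance:
  assumes "e > 0"
  shows "2 * e * (reg e w - reg_min e) \<le> (norm (gradf w + e *\<^sub>R w))\<^sup>2"
proof -
  let ?g = "gradf w + e *\<^sub>R w" and ?d = "reg_argmin e - w"
  have "0 \<le> (norm (?g + e *\<^sub>R ?d))\<^sup>2" by simp
  also have "\<dots> = (norm ?g)\<^sup>2 + 2 * e * (?g \<bullet> ?d + e / 2 * (norm ?d)\<^sup>2)"
    unfolding norm_add_scaleR_square by (simp add: power2_eq_square algebra_simps)
  also have "\<dots> \<le> (norm ?g)\<^sup>2 + 2 * e * (reg_min e - reg e w)"
    using reg_gradient_inequality[where e="e" and a="w" and b="reg_argmin e"] assms unfolding reg_min_def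
    by (intro add_left_mono mult_left_mono) auto
  finally show ?thesis by (simp add: algebra_simps)
qed

lemma reg_argmin_norm_le:
  assumes "e > 0" "p \<in> argmin f"
  shows "norm (reg_argmin e) \<le> norm p"
proof -
  have "e / 2 * (norm (reg_argmin e))\<^sup>2 \<le> e / 2 * (norm p)\<^sup>2"
    using reg_min_le[OF assms(1), of p] assms(2)[unfolded argmin_iff] unfolding reg_min_def
    by (smt (verit))
  then show ?thesis using assms(1) by (simp add: power2_le_iff_abs_le)
qed

text \<open>At \<open>reg_argmin e\<close> the gradient of \<open>f\<close> is \<open>- e *\<^sub>R reg_argmin e\<close>, so monotonicity of the gradient becomes
  a statement about the curve of minimisers alone.\<close>
lemma reg_argmin_monotone:
  assumes "e > 0" "d > 0"
  shows "(e *\<^sub>R reg_argmin e - d *\<^sub>R reg_argmin d) \<bullet> (reg_argmin e - reg_argmin d) \<le> 0"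
proof -
  have "gradf (reg_argmin e) = - (e *\<^sub>R reg_argmin e)" "gradf (reg_argmin d) = - (d *\<^sub>R reg_argmin d)"
    using reg_argmin_stationary assms by (auto simp: eq_neg_iff_add_eq_0)
  then show ?thesis
    using gradient_monotone[of "reg_argmin e" "reg_argmin d"]
    by (simp add: inner_diff_left inner_diff_right)
qed

text \<open>Monotonicity forces the angle at \<open>reg_argmin e\<close> between the origin and \<open>reg_argmin d\<close> to be obtuse,
  which gives Pythagoras with an inequality. Distances on the curve are thus controlled by the increments
  of a bounded monotone function, which is what yields strong convergence.\<close>
lemma reg_argmin_dist_square_le:
  assumes "0 < d" "d \<le> e"
  shows "(norm (reg_argmin e - reg_argmin d))\<^sup>2 \<le> (norm (reg_argmin d))\<^sup>2 - (norm (reg_argmin e))\<^sup>2"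
proof (cases "d = e")
  case False
  let ?a = "reg_argmin e" and ?h = "reg_argmin e - reg_argmin d"
  have "(e - d) * (?a \<bullet> ?h) + d * (norm ?h)\<^sup>2 \<le> 0"
    using reg_argmin_monotone[of e d] assms
    by (simp add: power2_norm_eq_inner algebra_simps inner_commute)
  moreover have "0 \<le> d * (norm ?h)\<^sup>2" using assms by simp
  ultimately have "(e - d) * (?a \<bullet> ?h) \<le> 0" by linarith
  then have "?a \<bullet> ?h \<le> 0" using assms False by (simp add: mult_le_0_iff)
  moreover have "(norm (reg_argmin d))\<^sup>2 = (norm ?a)\<^sup>2 - 2 * (?a \<bullet> ?h) + (norm ?h)\<^sup>2"
    by (simp add: power2_norm_eq_inner algebra_simps inner_commute)
  ultimately show ?thesis by linarith
qed simp

lemma reg_argmin_lipschitz: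
  assumes "0 < d" "0 < e" "p \<in> argmin f"
  shows "norm (reg_argmin d - reg_argmin e) \<le> \<bar>d - e\<bar> / e * norm p"
proof -
  let ?h = "reg_argmin d - reg_argmin e"
  have "e * (norm ?h)\<^sup>2 \<le> (e - d) * (reg_argmin d \<bullet> ?h)"
    using reg_argmin_monotone[of e d] assms by (simp add: power2_norm_eq_inner algebra_simps inner_commute)
  also have "\<dots> \<le> \<bar>e - d\<bar> * (norm p * norm ?h)"
    by (rule order.trans[OF abs_ge_self])
       (auto simp: abs_mult intro!: mult_left_mono order.trans[OF Cauchy_Schwarz_ineq2] mult_right_mono reg_argmin_norm_le assms)
  finally have "norm ?h * (e * norm ?h) \<le> norm ?h * (\<bar>d - e\<bar> * norm p)"
    by (simp add: power2_eq_square algebra_simps abs_minus_commute)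
  then have "e * norm ?h \<le> \<bar>d - e\<bar> * norm p" 
    by (cases "norm ?h = 0") (use assms in \<open>auto simp: mult_le_cancel_left\<close>)
  then show ?thesis using assms by (simp add: field_simps)
qed

text \<open>The envelope formula. Testing the minimality of each of two points of the curve with the other
  one encloses the increment of \<open>reg_min\<close> between two multiples of the increment of the parameter; the
  factors agree in the limit because the curve is locally Lipschitz.\<close>
lemma reg_min_has_derivative:
  assumes e: "e > 0"
  shows "(reg_min has_real_derivative (norm (reg_argmin e))\<^sup>2 / 2) (at e)"
proof -
  obtain p where p: "p \<in> argmin f" using nonempty by blast
  have upper: "reg_min b - reg_min a \<le> (b - a) / 2 * (norm (reg_argmin a))\<^sup>2" if "a > 0" "b > 0" for a b
    using reg_min_le[of b "reg_argmin a"] that unfolding reg_min_def[of a] by (simp add: algebra_simps diff_divide_distrib)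
  have norms: "\<bar>(norm (reg_argmin d))\<^sup>2 - (norm (reg_argmin e))\<^sup>2\<bar> \<le> 2 * (norm p)\<^sup>2 / e * \<bar>d - e\<bar>" if d: "d > 0" for d
  proof -
    have "\<bar>(norm (reg_argmin d))\<^sup>2 - (norm (reg_argmin e))\<^sup>2\<bar> = \<bar>norm (reg_argmin d) - norm (reg_argmin e)\<bar> * \<bar>norm (reg_argmin d) + norm (reg_argmin e)\<bar>"
      by (simp add: power2_eq_square square_diff_square_factored abs_mult mult.commute)
    also have "\<dots> \<le> (\<bar>d - e\<bar> / e * norm p) * (2 * norm p)"
      using reg_argmin_norm_le[OF e p] reg_argmin_norm_le[OF d p] e
      by (intro mult_mono order.trans[OF norm_triangle_ineq3 reg_argmin_lipschitz[OF d e p]]) auto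
    finally show ?thesis by (simp add: power2_eq_square mult_ac)
  qed
  have quot: "\<bar>(reg_min d - reg_min e) / (d - e) - (norm (reg_argmin e))\<^sup>2 / 2\<bar> \<le> (norm p)\<^sup>2 / e * \<bar>d - e\<bar>"
    if d: "d > 0" "d \<noteq> e" for d
  proof -
    let ?D = "reg_min d - reg_min e - (d - e) / 2 * (norm (reg_argmin e))\<^sup>2"
    have "?D \<le> 0" using upper[of e d] d e by simp
    moreover have "(d - e) / 2 * ((norm (reg_argmin d))\<^sup>2 - (norm (reg_argmin e))\<^sup>2) \<le> ?D"
      using upper[of d e] d e by (simp add: algebra_simps diff_divide_distrib)
    ultimately have "\<bar>?D\<bar> \<le> \<bar>(d - e) / 2 * ((norm (reg_argmin d))\<^sup>2 - (norm (reg_argmin e))\<^sup>2)\<bar>" by linarith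
    also have "\<dots> \<le> \<bar>d - e\<bar> / 2 * (2 * (norm p)\<^sup>2 / e * \<bar>d - e\<bar>)"
      unfolding abs_mult using norms[OF d(1)] by (intro mult_mono) auto
    finally have "\<bar>?D\<bar> / \<bar>d - e\<bar> \<le> (norm p)\<^sup>2 / e * \<bar>d - e\<bar>"
      using d by (simp add: field_simps)
    moreover have "(reg_min d - reg_min e) / (d - e) - (norm (reg_argmin e))\<^sup>2 / 2 = ?D / (d - e)"
      using d by (simp add: field_simps)
    ultimately show ?thesis by (simp add: abs_divide)
  qed
  have "((\<lambda>d. (reg_min d - reg_min e) / (d - e) - (norm (reg_argmin e))\<^sup>2 / 2) \<longlongrightarrow> 0) (at e)"
  proof (rule Lim_null_comparison)
    show "\<forall>\<^sub>F d in at e. norm ((reg_min d - reg_min e) / (d - e) - (norm (reg_argmin e))\<^sup>2 / 2) \<le> (norm p)\<^sup>2 / e * \<bar>d - e\<bar>"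
      unfolding real_norm_def eventually_at using quot e
      by (intro exI[of _ e]) (auto simp: dist_real_def)
    have "((\<lambda>d. (norm p)\<^sup>2 / e * \<bar>d - e\<bar>) \<longlongrightarrow> (norm p)\<^sup>2 / e * \<bar>e - e\<bar>) (at e)"
      by (intro tendsto_intros)
    then show "((\<lambda>d. (norm p)\<^sup>2 / e * \<bar>d - e\<bar>) \<longlongrightarrow> 0) (at e)" by simp
  qed
  then show ?thesis
    unfolding has_field_derivative_iff using LIM_zero_iff by fast
qed

text \<open>The midpoint of two different minimisers of least norm would be a minimiser of smaller norm.\<close>
lemma argmin_min_norm_unique:
  assumes "p \<in> argmin f" "q \<in> argmin f"
    and "\<And>w. w \<in> argmin f \<Longrightarrow> norm p \<le> norm w" and "norm q \<le> norm p"
  shows "p = q"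
proof -
  let ?m = "(1/2) *\<^sub>R (p + q)"
  have "f ?m \<le> fmin"
    using reg_midpoint[where e="0" and a="p" and b="q"] assms(1,2)[THEN argmin_value] by simp
  then have "norm p \<le> norm ?m" using assms(3) argmin_iff_value by blast
  then have "(norm p)\<^sup>2 \<le> (norm ?m)\<^sup>2" by (intro power_mono) auto
  also have "\<dots> = ((norm p)\<^sup>2 + (norm q)\<^sup>2) / 2 - (norm (p - q))\<^sup>2 / 4"
    by (rule norm_midpoint_square)
  also have "\<dots> \<le> (norm p)\<^sup>2 - (norm (p - q))\<^sup>2 / 4"
    using power_mono[OF assms(4), of 2] by simp
  finally have "(norm (p - q))\<^sup>2 \<le> 0" by simp
  then show ?thesis by simp
qed

text \<open>Along \<open>e = 1 / (n + 1)\<close> the squared norms increase to a finite limit, so the points form a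
  Cauchy sequence, and the same estimate transfers the limit to all small \<open>e\<close>. The limit minimises \<open>f\<close>
  because the regularising term vanishes, and it has least norm because the whole curve stays
  below the norm of every minimiser. The existence of the element of minimum norm is obtained
  on the way.\<close>
lemma reg_argmin_tendsto_argmin:
  "min_norm_element (argmin f) \<in> argmin f \<and> (reg_argmin \<longlongrightarrow> min_norm_element (argmin f)) (at_right 0)"
proof -
  define u where "u n = reg_argmin (1 / real (Suc n))" for n
  define N where "N = (SUP n. (norm (u n))\<^sup>2)"
  obtain p0 where p0: "p0 \<in> argmin f" using nonempty by blast
  have mono: "(norm (reg_argmin e))\<^sup>2 \<le> (norm (reg_argmin d))\<^sup>2" if "0 < d" "d \<le> e" for d e
    using reg_argmin_dist_square_le[OF that] by (smt (verit) zero_le_power2)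
  have bdd: "bdd_above (range (\<lambda>n. (norm (u n))\<^sup>2))"
    unfolding u_def by (intro bdd_aboveI[of _ "(norm p0)\<^sup>2"]) (auto intro!: power_mono reg_argmin_norm_le p0)
  have inc: "incseq (\<lambda>n. (norm (u n))\<^sup>2)"
    unfolding u_def incseq_def by (intro allI impI mono) (auto intro!: divide_left_mono)
  have lim: "(\<lambda>n. (norm (u n))\<^sup>2) \<longlonglongrightarrow> N"
    unfolding N_def by (rule LIMSEQ_incseq_SUP[OF bdd inc])
  have le_N: "(norm (reg_argmin e))\<^sup>2 \<le> N" if "e > 0" for e
  proof -
    obtain n where "inverse (real (Suc n)) < e" using reals_Archimedean[OF \<open>e > 0\<close>] by blast
    then have "(norm (reg_argmin e))\<^sup>2 \<le> (norm (u n))\<^sup>2"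
      unfolding u_def by (intro mono) (auto simp: inverse_eq_divide)
    also have "\<dots> \<le> N" unfolding N_def by (rule cSUP_upper[OF _ bdd]) simp
    finally show ?thesis .
  qed
  have dist_N: "(norm (u n - reg_argmin d))\<^sup>2 \<le> N - (norm (u n))\<^sup>2" if "0 < d" "d \<le> 1 / real (Suc n)" for n d
    using reg_argmin_dist_square_le[OF that] le_N[OF that(1)] unfolding u_def by linarith
  have small: "\<exists>n. \<forall>d. 0 < d \<and> d \<le> 1 / real (Suc n) \<longrightarrow> norm (u n - reg_argmin d) < c" if c: "c > 0" for c
  proof -
    have "\<forall>\<^sub>F n in sequentially. N - c\<^sup>2 < (norm (u n))\<^sup>2"
      using c by (intro order_tendstoD[OF lim]) auto
    then obtain n where n: "N - c\<^sup>2 < (norm (u n))\<^sup>2" by (auto simp: eventually_sequentially)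
    have "norm (u n - reg_argmin d) < c" if "0 < d" "d \<le> 1 / real (Suc n)" for d
      by (rule power2_less_imp_less) (use dist_N[OF that] n c in linarith)+
    then show ?thesis by blast
  qed
  have "Cauchy u"
  proof (rule metric_CauchyI)
    fix c :: real assume c: "c > 0"
    then obtain n where n: "\<And>d. 0 < d \<Longrightarrow> d \<le> 1 / real (Suc n) \<Longrightarrow> norm (u n - reg_argmin d) < c / 2"
      using small[of "c/2"] by auto
    have "dist (u n) (u i) < c / 2" if "n \<le> i" for i
      unfolding dist_norm u_def[of i] using that by (intro n) (auto intro!: divide_left_mono)
    then show "\<exists>M. \<forall>m\<ge>M. \<forall>n\<ge>M. dist (u m) (u n) < c"
      by (meson dist_triangle_half_r)
  qed
  then obtain p where p: "u \<longlonglongrightarrow> p" by (auto simp: Cauchy_convergent_iff convergent_def)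
  have tends: "(reg_argmin \<longlongrightarrow> p) (at_right 0)"
  proof (rule tendstoI)
    fix c :: real assume c: "c > 0"
    then obtain n where n: "\<And>d. 0 < d \<Longrightarrow> d \<le> 1 / real (Suc n) \<Longrightarrow> norm (u n - reg_argmin d) < c / 3"
      using small[of "c/3"] by auto
    have "norm (u n - p) \<le> c / 3"
    proof (rule LIMSEQ_le_const2)
      show "(\<lambda>i. norm (u n - u i)) \<longlonglongrightarrow> norm (u n - p)" by (intro tendsto_intros p)
      have "norm (u n - u i) < c / 3" if "n \<le> i" for i
        unfolding u_def[of i] using that by (intro n) (auto intro!: divide_left_mono)
      then show "\<exists>M. \<forall>i\<ge>M. norm (u n - u i) \<le> c / 3" by (auto intro: less_imp_le)
    qed
    then have "dist (reg_argmin d) p < c" if "0 < d" "d < 1 / real (Suc n)" for d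
      using n[of d] that norm_triangle_ineq[of "reg_argmin d - u n" "u n - p"] c
      by (simp add: dist_norm norm_minus_commute)
    then show "\<forall>\<^sub>F d in at_right 0. dist (reg_argmin d) p < c"
      unfolding eventually_at_right_field by (intro exI[of _ "1 / real (Suc n)"]) auto
  qed
  have p_norm: "norm p \<le> norm q" if "q \<in> argmin f" for q
    by (rule LIMSEQ_le_const2[OF tendsto_norm[OF p]]) (auto simp: u_def intro!: reg_argmin_norm_le that)
  have "f p \<le> fmin"
  proof -
    have "(\<lambda>n. f (u n)) \<longlonglongrightarrow> f p"
      by (intro continuous_on_tendsto_compose[OF continuous_f[of UNIV]] p) auto
    moreover have "(\<lambda>n. fmin + (1 / real (Suc n)) / 2 * (norm p0)\<^sup>2) \<longlonglongrightarrow> fmin + 0 / 2 * (norm p0)\<^sup>2"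
      using LIMSEQ_Suc[OF lim_1_over_n] by (intro tendsto_intros) auto
    ultimately have "f p \<le> fmin + 0 / 2 * (norm p0)\<^sup>2"
    proof (rule LIMSEQ_le)
      have "f (u n) \<le> fmin + (1 / real (Suc n)) / 2 * (norm p0)\<^sup>2" for n
      proof -
        have "f (u n) \<le> reg_min (1 / real (Suc n))" unfolding reg_min_def u_def by simp
        then show ?thesis
          using reg_min_le[of "1 / real (Suc n)" p0] argmin_value[OF p0] by simp
      qed
      then show "\<exists>M. \<forall>n\<ge>M. f (u n) \<le> fmin + (1 / real (Suc n)) / 2 * (norm p0)\<^sup>2" by blast
    qed
    then show ?thesis by simp
  qed
  then have pS: "p \<in> argmin f" by (simp add: argmin_iff_value)
  have "is_arg_min norm (\<lambda>w. w \<in> argmin f) p"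
    using pS p_norm by (auto simp: is_arg_min_linorder)
  then have "is_arg_min norm (\<lambda>w. w \<in> argmin f) (min_norm_element (argmin f))"
    unfolding min_norm_element_def arg_min_def by (rule someI)
  then have "p = min_norm_element (argmin f)"
    using pS p_norm by (intro argmin_min_norm_unique) (auto simp: is_arg_min_linorder)
  with tends pS show ?thesis by simp
qed

lemmas argmin_min_norm_element = reg_argmin_tendsto_argmin[THEN conjunct1]
  and reg_argmin_tendsto = reg_argmin_tendsto_argmin[THEN conjunct2]

lemma reg_argmin_tendsto_compose:
  assumes "(e \<longlongrightarrow> 0) F" "\<forall>\<^sub>F t in F. 0 < e t"
  shows "((\<lambda>t. reg_argmin (e t)) \<longlongrightarrow> min_norm_element (argmin f)) F"
proof -
  have "filterlim e (at_right 0) F"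
    by (rule tendsto_imp_filterlim_at_right[OF assms])
  then show ?thesis
    by (rule filterlim_compose[OF reg_argmin_tendsto])
qed

end

section \<open>The regularised gradient flow\<close>

text \<open>The factor \<open>k * t\<close> is the speed of the flow and \<open>c * t powr (- 2 * r)\<close> the vanishing
  regularisation parameter. With \<open>s = k * t\<^sup>2 / 2\<close> as time this is the flow with speed one and a
  parameter proportional to \<open>s powr (- r)\<close>; working in \<open>t\<close> avoids the change of variables.\<close>
locale tikhonov_flow = convex_gradient f gradf
  for f :: "'a::{real_inner, complete_space} \<Rightarrow> real" and gradf +
  fixes y :: "real \<Rightarrow> 'a" and k c r T0 :: real
  assumes k: "k > 0" and c: "c > 0" and r: "0 < r" "r < 1" and T0: "T0 > 0"
    and flow: "\<And>t. t \<ge> T0 \<Longrightarrow>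
      (y has_vector_derivative - (k * t) *\<^sub>R (gradf (y t) + (c * t powr (- 2 * r)) *\<^sub>R y t)) (at t)"
begin

definition eps :: "real \<Rightarrow> real" where "eps t = c * t powr (- 2 * r)"

definition energy :: "real \<Rightarrow> real" where
  "energy t = reg (eps t) (y t) - reg_min (eps t)"

lemma eps_pos: "t > 0 \<Longrightarrow> eps t > 0"
  unfolding eps_def using c by simp

lemma eps_deriv:
  assumes "t > 0"
  shows "(eps has_real_derivative - (2 * r / t) * eps t) (at t)"
proof -
  have "(eps has_real_derivative c * ((- 2 * r) * t powr (- 2 * r - 1))) (at t)"
    unfolding eps_def using assms by (intro DERIV_cmult has_real_derivative_powr)
  then show ?thesis using assms by (simp add: eps_def powr_diff mult_ac)
qed

lemma eps_tendsto: "(eps \<longlongrightarrow> 0) at_top"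
proof -
  have "((\<lambda>t. t powr (- 2 * r)) \<longlongrightarrow> 0) at_top"
    by (rule tendsto_neg_powr) (use r in \<open>auto intro: filterlim_ident\<close>)
  then have "(eps \<longlongrightarrow> c * 0) at_top"
    unfolding eps_def by (intro tendsto_intros)
  then show ?thesis by simp
qed

lemma norm_square_gap:
  assumes "t > 0" "p \<in> argmin f"
  shows "(norm (reg_argmin (eps t)))\<^sup>2 - (norm (y t))\<^sup>2 \<le> 2 * norm p * norm (y t - reg_argmin (eps t))"
proof -
  let ?z = "reg_argmin (eps t)"
  have "(norm ?z)\<^sup>2 - (norm (y t))\<^sup>2 = - 2 * (?z \<bullet> (y t - ?z)) - (norm (y t - ?z))\<^sup>2"
    by (simp add: power2_norm_eq_inner algebra_simps inner_commute)
  also have "\<dots> \<le> 2 * \<bar>?z \<bullet> (y t - ?z)\<bar>"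
    by (smt (verit) zero_le_power2)
  also have "\<dots> \<le> 2 * (norm ?z * norm (y t - ?z))"
    using Cauchy_Schwarz_ineq2 by (intro mult_left_mono) auto
  also have "\<dots> \<le> 2 * (norm p * norm (y t - ?z))"
    using reg_argmin_norm_le[OF eps_pos[OF assms(1)] assms(2)] by (intro mult_left_mono mult_right_mono) auto
  finally show ?thesis by simp
qed

text \<open>Two effects compete. Gradient dominance lets the flow dissipate the energy at rate
  \<open>2 * k * t * eps t\<close>. The decrease of \<open>eps\<close> adds a multiple of
  \<open>\<parallel>reg_argmin (eps t)\<parallel>\<^sup>2 - \<parallel>y t\<parallel>\<^sup>2\<close>, which is at most linear in \<open>\<parallel>y t - reg_argmin (eps t)\<parallel>\<close>; by
  Young's inequality half of the dissipation absorbs it, up to a term of order \<open>1 / t ^ 3\<close>.\<close>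
lemma energy_deriv:
  assumes t: "t \<ge> T0" and p: "p \<in> argmin f"
  obtains W' where "(energy has_real_derivative W') (at t)"
    and "W' \<le> 2 * r\<^sup>2 * (norm p)\<^sup>2 / (k * t ^ 3) - k * t * eps t * energy t"
proof -
  have t0: "t > 0" using t T0 by simp
  define e z g e' where "e = eps t" and "z = reg_argmin e" and "g = gradf (y t) + e *\<^sub>R y t"
    and "e' = - (2 * r / t) * e"
  have e: "e > 0" unfolding e_def using eps_pos[OF t0] .
  define v where "v = - (k * t) *\<^sub>R g"
  have y: "(y has_vector_derivative v) (at t)"
    using flow[OF t] unfolding v_def g_def e_def eps_def .
  define W' where "W' = gradf (y t) \<bullet> v + (e' / 2 * (norm (y t))\<^sup>2 + 2 * (y t \<bullet> v) * (e / 2))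
     - (norm z)\<^sup>2 / 2 * e'"
  have "(energy has_real_derivative W') (at t)"
    unfolding energy_def W'_def e'_def e_def z_def
    by (intro DERIV_diff DERIV_add DERIV_mult DERIV_cdivide gradient_chain_rule grad y eps_deriv
        has_real_derivative_norm_square t0 DERIV_chain2[OF reg_min_has_derivative] eps_pos)
  moreover have "W' \<le> 2 * r\<^sup>2 * (norm p)\<^sup>2 / (k * t ^ 3) - k * t * e * energy t"
  proof -
    define n where "n = norm (y t - z)"
    have "W' = g \<bullet> v + e' / 2 * ((norm (y t))\<^sup>2 - (norm z)\<^sup>2)"
      unfolding W'_def g_def by (simp add: inner_add_left algebra_simps diff_divide_distrib)
    also have "g \<bullet> v = - (k * t) * (norm g)\<^sup>2"
      unfolding v_def by (simp add: power2_norm_eq_inner)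
    also have "e' / 2 * ((norm (y t))\<^sup>2 - (norm z)\<^sup>2) = r / t * e * ((norm z)\<^sup>2 - (norm (y t))\<^sup>2)"
      unfolding e'_def by (simp add: algebra_simps diff_divide_distrib)
    finally have W': "W' = - (k * t * (norm g)\<^sup>2) + r / t * e * ((norm z)\<^sup>2 - (norm (y t))\<^sup>2)" by simp
    have E: "energy t = reg e (y t) - reg_min e" unfolding energy_def e_def ..
    have "k * t * (2 * e * energy t) \<le> k * t * (norm g)\<^sup>2"
      using reg_gradient_dominance[OF e, of "y t"] k t0 unfolding g_def E by (intro mult_left_mono) auto
    then have 1: "2 * (k * t * e * energy t) \<le> k * t * (norm g)\<^sup>2" by (simp only: mult_ac)
    have 2: "r / t * e * ((norm z)\<^sup>2 - (norm (y t))\<^sup>2) \<le> r / t * e * (2 * norm p * n)"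
      using norm_square_gap[OF t0 p] r t0 e unfolding z_def e_def n_def by (intro mult_left_mono) auto
    have 3: "k * t * e * (e / 2 * n\<^sup>2) \<le> k * t * e * energy t"
      using reg_growth[OF e, of "y t"] k t0 e unfolding E n_def z_def by (intro mult_left_mono) auto
    \<comment> \<open>Young's inequality, as the expansion of a square whose weights leave exactly half of the
      dissipation.\<close>
    have "0 \<le> (k * t\<^sup>2 * e * n - 2 * r * norm p)\<^sup>2 / (2 * k * t ^ 3)"
      using k t0 by simp
    also have "\<dots> = k * t * e * (e / 2 * n\<^sup>2) - r / t * e * (2 * norm p * n)
        + 2 * r\<^sup>2 * (norm p)\<^sup>2 / (k * t ^ 3)"
      using k t0 by (simp add: field_simps power2_eq_square power3_eq_cube)
    finally have 4: "r / t * e * (2 * norm p * n)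
        \<le> k * t * e * (e / 2 * n\<^sup>2) + 2 * r\<^sup>2 * (norm p)\<^sup>2 / (k * t ^ 3)" by simp
    have "w \<le> d - a" if "w = - g + h" "2 * a \<le> g" "h \<le> j" "j \<le> b + d" "b \<le> a"
      for w d a g h j b :: real
      using that by linarith
    from this[OF W' 1 2 4 3] show ?thesis .
  qed
  ultimately show ?thesis using that unfolding e_def by blast
qed

lemma energy_nonneg: "t > 0 \<Longrightarrow> 0 \<le> energy t"
  unfolding energy_def using reg_min_le[OF eps_pos] by simp

text \<open>Multiplication by \<open>t powr (4 - 2 * r)\<close> balances the contraction rate \<open>k * c * t powr (1 - 2 * r)\<close>
  against the source \<open>1 / t ^ 3\<close>. The derivative of the weight costs \<open>(4 - 2 * r) / t\<close>, which is
  dominated by half of the contraction rate for large \<open>t\<close> because \<open>r < 1\<close>; then \<open>relaxation_bound\<close>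
  applies.\<close>
lemma energy_bound:
  "\<exists>K T. K \<ge> 0 \<and> T \<ge> T0 \<and> T \<ge> 1 \<and> (\<forall>t\<ge>T. energy t \<le> K * t powr (2 * r - 4))"
proof -
  obtain p where p: "p \<in> argmin f" using nonempty by blast
  define D where "D = 2 * r\<^sup>2 * (norm p)\<^sup>2 / k"
  have D: "D \<ge> 0" unfolding D_def using k by simp
  have "filterlim (\<lambda>t. t powr (2 - 2 * r)) at_top at_top"
    using r by (intro real_powr_at_top) auto
  \<comment> \<open>Since \<open>4 - 2 * r < 4\<close>, this threshold puts \<open>(4 - 2 * r) / t\<close> below half of the contraction
    rate.\<close>
  then have "\<forall>\<^sub>F t in at_top. 8 / (k * c) \<le> t powr (2 - 2 * r)"
    by (simp add: filterlim_at_top)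
  then obtain T1 where T1: "\<And>t. t \<ge> T1 \<Longrightarrow> 8 / (k * c) \<le> t powr (2 - 2 * r)"
    by (auto simp: eventually_at_top_linorder)
  define T where "T = max T1 (max T0 1)"
  define P where "P t = t powr (4 - 2 * r) * energy t" for t
  define a where "a t = k * c / 2 * t powr (1 - 2 * r)" for t
  define A where "A t = k * c / (2 * (2 - 2 * r)) * t powr (2 - 2 * r)" for t
  define C where "C = 2 * D / (k * c)"
  have T: "T \<ge> T1" "T \<ge> T0" "T \<ge> 1" unfolding T_def by auto
  have A: "(A has_real_derivative a t) (at t)" if "T \<le> t" for t
  proof -
    have "(A has_real_derivative k * c / (2 * (2 - 2 * r)) * ((2 - 2 * r) * t powr (2 - 2 * r - 1))) (at t)"
      unfolding A_def using that T by (intro DERIV_cmult has_real_derivative_powr) auto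
    moreover have "k * c / (2 * (2 - 2 * r)) * ((2 - 2 * r) * t powr (2 - 2 * r - 1)) = a t"
      unfolding a_def using r by (simp add: divide_simps)
    ultimately show ?thesis by simp
  qed
  have "\<exists>P'. (P has_real_derivative P') (at t) \<and> P' \<le> a t * (C - P t)" if "T \<le> t" for t
  proof -
    have t: "t \<ge> T0" "t > 0" "t \<ge> T1" using that T by auto
    obtain W' where W': "(energy has_real_derivative W') (at t)"
      "W' \<le> 2 * r\<^sup>2 * (norm p)\<^sup>2 / (k * t ^ 3) - k * t * eps t * energy t"
      using energy_deriv[OF t(1) p] .
    define s where "s = t powr (- 2 * r)"
    have s: "s > 0" unfolding s_def using t by simp
    have pw: "t powr (4 - 2 * r) = t ^ 4 * s" "t powr (4 - 2 * r - 1) = t ^ 3 * s"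
      "t powr (1 - 2 * r) = t * s" "t powr (2 - 2 * r) = t\<^sup>2 * s"
      unfolding s_def using t(2) powr_add[of t 4 "- 2 * r"] powr_add[of t 3 "- 2 * r"]
        powr_add[of t 1 "- 2 * r"] powr_add[of t 2 "- 2 * r"] by (simp_all add: powr_numeral)
    have d: "(P has_real_derivative ((4 - 2 * r) * t powr (4 - 2 * r - 1)) * energy t + W' * t powr (4 - 2 * r)) (at t)"
      unfolding P_def by (intro DERIV_mult has_real_derivative_powr t W')
    have "8 \<le> k * c * (t\<^sup>2 * s)"
      using T1[OF t(3)] k c unfolding pw by (simp add: field_simps)
    then have "(4 - 2 * r) \<le> k * c / 2 * (t\<^sup>2 * s)" using r by simp
    then have 1: "(4 - 2 * r) * (t ^ 3 * s * energy t) \<le> k * c / 2 * (t\<^sup>2 * s) * (t ^ 3 * s * energy t)"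
      using energy_nonneg[OF t(2)] s t by (intro mult_right_mono) auto
    have "W' \<le> D / t ^ 3 - k * c * (t * s) * energy t"
      using W'(2) unfolding D_def eps_def s_def by (simp add: mult_ac)
    then have "W' * (t ^ 4 * s) \<le> (D / t ^ 3 - k * c * (t * s) * energy t) * (t ^ 4 * s)"
      using s t by (intro mult_right_mono) auto
    also have "\<dots> = D * (t * s) - k * c * (t\<^sup>2 * s) * (t ^ 3 * s * energy t)"
      using t by (simp add: field_simps power2_eq_square eval_nat_numeral)
    finally have 2: "W' * (t ^ 4 * s) \<le> D * (t * s) - k * c * (t\<^sup>2 * s) * (t ^ 3 * s * energy t)" .
    have "a t * (C - P t) = D * (t * s) - k * c / 2 * (t\<^sup>2 * s) * (t ^ 3 * s * energy t)"
      unfolding a_def C_def P_def pw using k c by (simp add: field_simps power2_eq_square eval_nat_numeral)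
    with 1 2 have "((4 - 2 * r) * t powr (4 - 2 * r - 1)) * energy t + W' * t powr (4 - 2 * r) \<le> a t * (C - P t)"
      unfolding pw by (simp add: mult.assoc)
    with d show ?thesis by blast
  qed
  then obtain P' where P': "\<And>t. T \<le> t \<Longrightarrow> (P has_real_derivative P' t) (at t)"
    "\<And>t. T \<le> t \<Longrightarrow> P' t \<le> a t * (C - P t)" by metis
  define K where "K = max (P T) C"
  have "energy t \<le> K * t powr (2 * r - 4)" if "t \<ge> T" for t
  proof -
    have t: "t > 0" using that T by simp
    have "P t \<le> K" unfolding K_def
      by (rule relaxation_bound[OF that P'(1) A _ P'(2)]) (use k c in \<open>auto simp: a_def\<close>)
    then have "t powr (4 - 2 * r) * energy t * t powr (2 * r - 4) \<le> K * t powr (2 * r - 4)"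
      unfolding P_def by (intro mult_right_mono) auto
    moreover have "t powr (4 - 2 * r) * t powr (2 * r - 4) = 1"
      using t by (simp add: powr_add[symmetric])
    ultimately show ?thesis by (simp add: mult_ac)
  qed
  moreover have "K \<ge> 0" unfolding K_def C_def using D k c by (simp add: le_max_iff_disj)
  ultimately show ?thesis using T by blast
qed

lemma tracking:
  "\<exists>K T. K \<ge> 0 \<and> T \<ge> T0 \<and> T \<ge> 1 \<and>
    (\<forall>t\<ge>T. norm (y t - reg_argmin (eps t)) \<le> K * t powr (2 * r - 2) \<and> energy t \<le> K * t powr (- 2))"
proof -
  obtain K T where K: "K \<ge> 0" "T \<ge> T0" "T \<ge> 1" "\<And>t. t \<ge> T \<Longrightarrow> energy t \<le> K * t powr (2 * r - 4)"
    using energy_bound by blast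
  define K' where "K' = max K (sqrt (2 * K / c))"
  have 1: "norm (y t - reg_argmin (eps t)) \<le> K' * t powr (2 * r - 2)" if "t \<ge> T" for t
  proof -
    have t: "t > 0" using that K by simp
    have "eps t / 2 * (norm (y t - reg_argmin (eps t)))\<^sup>2 \<le> K * t powr (2 * r - 4)"
      using reg_growth[OF eps_pos[OF t], of "y t"] K(4)[OF that] unfolding energy_def by linarith
    then have "2 / eps t * (eps t / 2 * (norm (y t - reg_argmin (eps t)))\<^sup>2) \<le> 2 / eps t * (K * t powr (2 * r - 4))"
      using eps_pos[OF t] by (intro mult_left_mono) auto
    then have "(norm (y t - reg_argmin (eps t)))\<^sup>2 \<le> 2 / eps t * (K * t powr (2 * r - 4))"
      using eps_pos[OF t] by simp
    also have "\<dots> = 2 * K / c * (t powr (2 * r) * t powr (2 * r - 4))"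
      unfolding eps_def using t c by (simp add: powr_minus field_simps)
    also have "t powr (2 * r) * t powr (2 * r - 4) = (t powr (2 * r - 2))\<^sup>2"
      by (simp add: powr_add[symmetric] power2_eq_square)
    also have "2 * K / c = (sqrt (2 * K / c))\<^sup>2" using K(1) c by simp
    also have "(sqrt (2 * K / c))\<^sup>2 * (t powr (2 * r - 2))\<^sup>2 = (sqrt (2 * K / c) * t powr (2 * r - 2))\<^sup>2"
      by (simp add: power_mult_distrib)
    finally have "norm (y t - reg_argmin (eps t)) \<le> sqrt (2 * K / c) * t powr (2 * r - 2)"
      by (rule power2_le_imp_le) (use K c in auto)
    also have "\<dots> \<le> K' * t powr (2 * r - 2)" unfolding K'_def by (intro mult_right_mono) auto
    finally show ?thesis .
  qed
  have 2: "energy t \<le> K' * t powr (- 2)" if "t \<ge> T" for t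
  proof -
    have "energy t \<le> K * t powr (2 * r - 4)" using K(4)[OF that] .
    also have "\<dots> \<le> K' * t powr (- 2)"
      unfolding K'_def using that K r by (intro mult_mono powr_mono) auto
    finally show ?thesis .
  qed
  have "K' \<ge> 0" unfolding K'_def using K by simp
  with 1 2 K show ?thesis by blast
qed

lemma flow_tendsto: "(y \<longlongrightarrow> min_norm_element (argmin f)) at_top"
proof -
  obtain K T where K: "K \<ge> 0" "T \<ge> T0" "T \<ge> 1"
    "\<And>t. t \<ge> T \<Longrightarrow> norm (y t - reg_argmin (eps t)) \<le> K * t powr (2 * r - 2)"
    using tracking by blast
  have "((\<lambda>t. K * t powr (2 * r - 2)) \<longlongrightarrow> K * 0) at_top"
    using r by (intro tendsto_intros tendsto_neg_powr filterlim_ident) auto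
  then have K0: "((\<lambda>t. K * t powr (2 * r - 2)) \<longlongrightarrow> 0) at_top" by simp
  have "((\<lambda>t. y t - reg_argmin (eps t)) \<longlongrightarrow> 0) at_top"
    by (rule Lim_null_comparison[OF _ K0])
      (use K(4) in \<open>auto simp: eventually_at_top_linorder\<close>)
  moreover have "((\<lambda>t. reg_argmin (eps t)) \<longlongrightarrow> min_norm_element (argmin f)) at_top"
    by (rule reg_argmin_tendsto_compose[OF eps_tendsto])
      (use eps_pos in \<open>auto intro: eventually_mono[OF eventually_gt_at_top[of 0]]\<close>)
  ultimately show ?thesis using tendsto_add by fastforce
qed

text \<open>The values at \<open>y t\<close> and on the Tikhonov curve differ by the energy and by
  \<open>eps t / 2\<close> times the difference of the squared norms. The latter is of order
  \<open>t powr (- 2 * r) * t powr (2 * r - 2)\<close>, independently of \<open>r\<close>.\<close>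
lemma value_gap:
  "\<exists>K T. K \<ge> 0 \<and> T \<ge> T0 \<and> T \<ge> 1 \<and>
    (\<forall>t\<ge>T. f (y t) - fmin \<le> (f (reg_argmin (eps t)) - fmin) + K * t powr (- 2))"
proof -
  obtain p where p: "p \<in> argmin f" using nonempty by blast
  obtain K T where K: "K \<ge> 0" "T \<ge> T0" "T \<ge> 1"
    "\<And>t. t \<ge> T \<Longrightarrow> norm (y t - reg_argmin (eps t)) \<le> K * t powr (2 * r - 2)"
    "\<And>t. t \<ge> T \<Longrightarrow> energy t \<le> K * t powr (- 2)"
    using tracking by blast
  have "f (y t) - fmin \<le> (f (reg_argmin (eps t)) - fmin) + (K + c * norm p * K) * t powr (- 2)" if "t \<ge> T" for t
  proof -
    have t: "t > 0" using that K by simp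
    have "f (y t) - f (reg_argmin (eps t)) = energy t + eps t / 2 * ((norm (reg_argmin (eps t)))\<^sup>2 - (norm (y t))\<^sup>2)"
      unfolding energy_def reg_min_def by (simp add: algebra_simps diff_divide_distrib)
    also have "\<dots> \<le> K * t powr (- 2) + eps t / 2 * (2 * norm p * (K * t powr (2 * r - 2)))"
    proof (intro add_mono mult_left_mono K(5) that)
      show "(norm (reg_argmin (eps t)))\<^sup>2 - (norm (y t))\<^sup>2 \<le> 2 * norm p * (K * t powr (2 * r - 2))"
        by (rule order.trans[OF norm_square_gap[OF t p]]) (use K(4)[OF that] in \<open>auto intro!: mult_left_mono\<close>)
      show "0 \<le> eps t / 2" using eps_pos[OF t] by simp
    qed
    also have "eps t / 2 * (2 * norm p * (K * t powr (2 * r - 2)))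
        = c * norm p * K * (t powr (- 2 * r) * t powr (2 * r - 2))"
      unfolding eps_def by simp
    also have "t powr (- 2 * r) * t powr (2 * r - 2) = t powr (- 2)"
      by (simp add: powr_add[symmetric])
    finally show ?thesis by (simp add: algebra_simps)
  qed
  moreover have "K + c * norm p * K \<ge> 0" using K c by simp
  ultimately show ?thesis using K by blast
qed

text \<open>A bounded antiderivative, up to a constant factor, of
  \<open>t powr (2 * r - 1) * (f (reg_argmin (eps t)) - fmin)\<close>. Its boundedness says that the values along the
  Tikhonov curve are integrable against this weight, which is more than the pointwise bound
  \<open>f (reg_argmin e) - fmin = O(e)\<close> gives.\<close>
definition gap_ratio :: "real \<Rightarrow> real" where
  "gap_ratio t = (reg_min (eps t) - fmin) / eps t"

lemma gap_ratio_bounds: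
  assumes t: "t > 0" and p: "p \<in> argmin f"
  shows "0 \<le> gap_ratio t" "gap_ratio t \<le> (norm p)\<^sup>2 / 2"
proof -
  have "fmin \<le> reg_min (eps t)"
    unfolding reg_min_def using fmin_le[of "reg_argmin (eps t)"] eps_pos[OF t] by (simp add: add_increasing2)
  then show "0 \<le> gap_ratio t" unfolding gap_ratio_def using eps_pos[OF t] by simp
  have "reg_min (eps t) - fmin \<le> eps t / 2 * (norm p)\<^sup>2"
    using reg_min_le[OF eps_pos[OF t], of p] argmin_value[OF p] by simp
  then show "gap_ratio t \<le> (norm p)\<^sup>2 / 2"
    unfolding gap_ratio_def using eps_pos[OF t] by (simp add: field_simps)
qed

text \<open>By the envelope formula the derivative of \<open>(reg_min e - fmin) / e\<close> in \<open>e\<close> is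
  \<open>- (f (reg_argmin e) - fmin) / e\<^sup>2\<close>, the norm terms cancelling exactly.\<close>
lemma gap_ratio_deriv:
  assumes t: "t > 0"
  shows "(gap_ratio has_real_derivative 2 * r / c * t powr (2 * r - 1) * (f (reg_argmin (eps t)) - fmin)) (at t)"
proof -
  define e z where "e = eps t" and "z = reg_argmin e"
  have e: "e > 0" unfolding e_def using eps_pos[OF t] .
  have "(gap_ratio has_real_derivative
      (((norm z)\<^sup>2 / 2 * (- (2 * r / t) * e) - 0) * e - (reg_min e - fmin) * (- (2 * r / t) * e)) / (e * e)) (at t)"
    unfolding gap_ratio_def e_def z_def
    by (intro DERIV_divide DERIV_diff DERIV_const eps_deriv t DERIV_chain2[OF reg_min_has_derivative] eps_pos)
       (use eps_pos[OF t] in auto)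
  then show ?thesis
  proof (rule DERIV_cong)
    have "(((norm z)\<^sup>2 / 2 * (- (2 * r / t) * e) - 0) * e - (reg_min e - fmin) * (- (2 * r / t) * e)) / (e * e)
        = 2 * r / t * (f z - fmin) / e"
      unfolding reg_min_def z_def[symmetric] using e t by (simp add: field_simps)
    also have "\<dots> = 2 * r / c * t powr (2 * r - 1) * (f z - fmin)"
      unfolding e_def eps_def using t c by (simp add: powr_minus powr_diff divide_simps)
    finally show "(((norm z)\<^sup>2 / 2 * (- (2 * r / t) * e) - 0) * e - (reg_min e - fmin) * (- (2 * r / t) * e)) / (e * e)
        = 2 * r / c * t powr (2 * r - 1) * (f (reg_argmin (eps t)) - fmin)"
      unfolding z_def e_def .
  qed
qed

section \<open>Values along the averaged trajectory\<close>

text \<open>By convexity \<open>t powr a * (f (x t) - fmin)\<close> grows at most at rate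
  \<open>a * t powr (a - 1) * (f (y t) - fmin)\<close>, a differential form of Jensen's inequality. Using
  \<open>value_gap\<close>, this rate is at most \<open>a * t powr (a - 2 * r)\<close> times the derivative of a bounded increasing
  function \<open>R\<close>, composed of \<open>gap_ratio\<close> and an integrable power. The monotone factor
  \<open>s powr (a - 2 * r)\<close> is largest at one of the two ends of the interval of integration, whichever the
  sign of the exponent, and the two ends account for the two terms of the rate.\<close>
lemma averaged_value_rate:
  fixes x :: "real \<Rightarrow> 'a"
  assumes a: "a > 0"
    and x: "\<And>t. t \<ge> T0 \<Longrightarrow> (x has_vector_derivative (a / t) *\<^sub>R (y t - x t)) (at t)"
  shows "\<exists>C T. \<forall>t\<ge>T. f (x t) - fmin \<le> C * (1 / t powr a + 1 / t powr (2 * r))"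
proof -
  obtain p where p: "p \<in> argmin f" using nonempty by blast
  obtain K T where K: "K \<ge> 0" "T \<ge> T0" "T \<ge> 1"
    "\<And>t. t \<ge> T \<Longrightarrow> f (y t) - fmin \<le> (f (reg_argmin (eps t)) - fmin) + K * t powr (- 2)"
    using value_gap by blast
  define F where "F t = t powr a * (f (x t) - fmin)" for t
  define F' where "F' t = t powr a * (gradf (x t) \<bullet> ((a / t) *\<^sub>R (y t - x t))) 
    + a * t powr (a - 1) * (f (x t) - fmin)" for t
  define R where "R t = c / (2 * r) * gap_ratio t - K / (2 - 2 * r) * t powr (2 * r - 2)" for t
  define R' where "R' t = t powr (2 * r - 1) * (f (reg_argmin (eps t)) - fmin) + K * t powr (2 * r - 3)" for t
  define b where "b = a - 2 * r"
  define B where "B = c / (2 * r) * ((norm p)\<^sup>2 / 2) + K / (2 - 2 * r) * T powr (2 * r - 2)"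
  have F: "(F has_real_derivative F' t) (at t)" if "T \<le> t" for t
  proof -
    have "(F has_real_derivative (a * t powr (a - 1)) * (f (x t) - fmin)
        + (gradf (x t) \<bullet> ((a / t) *\<^sub>R (y t - x t)) - 0) * t powr a) (at t)"
      unfolding F_def using that K
      by (intro DERIV_mult DERIV_diff DERIV_const has_real_derivative_powr gradient_chain_rule grad x) auto
    then show ?thesis unfolding F'_def by (simp add: mult_ac add_ac)
  qed
  have R: "(R has_real_derivative R' t) (at t)" if "T \<le> t" for t
  proof -
    have t: "t > 0" using that K by simp
    have "(R has_real_derivative c / (2 * r) * (2 * r / c * t powr (2 * r - 1) * (f (reg_argmin (eps t)) - fmin))
        - K / (2 - 2 * r) * ((2 * r - 2) * t powr (2 * r - 2 - 1))) (at t)"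
      unfolding R_def by (intro DERIV_diff DERIV_cmult gap_ratio_deriv has_real_derivative_powr t)
    moreover have "c / (2 * r) * (2 * r / c * t powr (2 * r - 1) * (f (reg_argmin (eps t)) - fmin))
        = t powr (2 * r - 1) * (f (reg_argmin (eps t)) - fmin)"
      using c r by simp
    moreover have "K / (2 - 2 * r) * ((2 * r - 2) * t powr (2 * r - 2 - 1)) = - (K * t powr (2 * r - 3))"
      using r by (simp add: divide_simps) (simp add: algebra_simps)
    ultimately show ?thesis unfolding R'_def by simp
  qed
  have R'_nonneg: "R' t \<ge> 0" for t
    unfolding R'_def using K(1) fmin_le by simp
  have F'_le: "F' t \<le> a * t powr b * R' t" if "T \<le> t" for t
  proof -
    have t: "t > 0" using that K by simp
    have pa: "t powr a * (a / t) = a * t powr (a - 1)" using t by (simp add: powr_diff)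
    have "F' t = (t powr a * (a / t)) * (gradf (x t) \<bullet> (y t - x t)) + a * t powr (a - 1) * (f (x t) - fmin)"
      unfolding F'_def by simp
    also have "\<dots> = a * t powr (a - 1) * (gradf (x t) \<bullet> (y t - x t) + f (x t) - fmin)"
      unfolding pa by (simp add: algebra_simps)
    also have "\<dots> \<le> a * t powr (a - 1) * ((f (reg_argmin (eps t)) - fmin) + K * t powr (- 2))"
      using a gradient_inequality[of "x t" "y t"] K(4)[OF that] by (intro mult_left_mono) auto
    also have "\<dots> = a * (t powr (a - 1) * (f (reg_argmin (eps t)) - fmin) + K * (t powr (a - 1) * t powr (- 2)))"
      by (simp add: algebra_simps)
    also have "\<dots> = a * t powr b * R' t"
    proof -
      have "t powr (a - 1) = t powr b * t powr (2 * r - 1)"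
        "t powr (a - 1) * t powr (- 2) = t powr b * t powr (2 * r - 3)"
        unfolding b_def by (simp_all add: powr_add[symmetric] algebra_simps)
      then show ?thesis unfolding R'_def by (simp add: algebra_simps)
    qed
    finally show ?thesis .
  qed
  have B: "R t - R T \<le> B" "B \<ge> 0" if "T \<le> t" for t
  proof -
    have "c / (2 * r) * gap_ratio t \<le> c / (2 * r) * ((norm p)\<^sup>2 / 2)"
      using gap_ratio_bounds(2)[OF _ p, of t] that K c r by (intro mult_left_mono) auto
    moreover have "0 \<le> c / (2 * r) * gap_ratio T"
      "0 \<le> K / (2 - 2 * r) * t powr (2 * r - 2)"
      "0 \<le> K / (2 - 2 * r) * T powr (2 * r - 2)"
      "0 \<le> c / (2 * r) * ((norm p)\<^sup>2 / 2)"
      using gap_ratio_bounds(1)[OF _ p, of T] K c r by auto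
    ultimately show "R t - R T \<le> B" "B \<ge> 0" unfolding R_def B_def by linarith+
  qed
  define C where "C = \<bar>F T\<bar> + a * T powr b * B + a * B"
  have "f (x t) - fmin \<le> C * (1 / t powr a + 1 / t powr (2 * r))" if t: "T \<le> t" for t
  proof -
    have t0: "t > 0" using that K by simp
    have "F t - F T \<le> a * (T powr b + t powr b) * R t - a * (T powr b + t powr b) * R T"
    proof (rule deriv_le_imp_increment_le[OF t])
      fix s assume s: "T \<le> s" "s \<le> t"
      show "(F has_real_derivative F' s) (at s)" by (rule F[OF s(1)])
      show "((\<lambda>s. a * (T powr b + t powr b) * R s) has_real_derivative a * (T powr b + t powr b) * R' s) (at s)"
        by (intro DERIV_cmult R s)
      have "s powr b \<le> T powr b + t powr b"
      proof (cases "b \<ge> 0")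
        case True
        then have "s powr b \<le> t powr b" using s K by (intro powr_mono2) auto
        then show ?thesis by (simp add: add_increasing)
      next
        case False
        then have "s powr b \<le> T powr b" using s K by (intro powr_mono2') auto
        then show ?thesis by (simp add: add_increasing2)
      qed
      then have "a * s powr b * R' s \<le> a * (T powr b + t powr b) * R' s"
        using a R'_nonneg by (intro mult_right_mono mult_left_mono) auto
      with F'_le[OF s(1)] show "F' s \<le> a * (T powr b + t powr b) * R' s" by linarith
    qed
    also have "\<dots> = a * (T powr b + t powr b) * (R t - R T)" by (simp add: algebra_simps)
    also have "\<dots> \<le> a * (T powr b + t powr b) * B"
      using a B[OF t] by (intro mult_left_mono) auto
    finally have "F t \<le> (\<bar>F T\<bar> + a * T powr b * B) * 1 + a * B * t powr b"
      by (simp add: algebra_simps)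
    also have "\<dots> \<le> C * 1 + C * t powr b"
    proof (intro add_mono mult_right_mono)
      have "0 \<le> a * T powr b * B" "0 \<le> a * B" using a B[OF t] by auto
      then show "\<bar>F T\<bar> + a * T powr b * B \<le> C" "a * B \<le> C" unfolding C_def by linarith+
    qed auto
    finally have "F t / t powr a \<le> (C * 1 + C * t powr b) / t powr a"
      by (intro divide_right_mono) auto
    moreover have "F t / t powr a = f (x t) - fmin" unfolding F_def using t0 by simp
    moreover have "(C * 1 + C * t powr b) / t powr a = C * (1 / t powr a + 1 / t powr (2 * r))"
      unfolding b_def using t0 by (simp add: powr_diff field_simps)
    ultimately show ?thesis by simp
  qed
  then show ?thesis by blast
qed

end

section \<open>The inertial system\<close>

theorem theorem7:
  fixes f :: "'a::{real_inner, complete_space} \<Rightarrow> real"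
    and gradf :: "'a \<Rightarrow> 'a"
    and x x' x'' :: "real \<Rightarrow> 'a"
    and r \<alpha> t0 :: real
  assumes convex: "convex_on UNIV f"
    and grad: "\<And>y. GDERIV f y :> gradf y"
    and C1: "continuous_on UNIV gradf"
    and lipschitz: "\<And>B. bounded B \<Longrightarrow> \<exists>L. L-lipschitz_on B gradf"
    and nonempty: "argmin f \<noteq> {}"
    and r: "0 < r" "r < 1"
    and \<alpha>: "\<alpha> > 1"
    and t0: "t0 > 0"
    and C2: "C2_with_derivs t0 x x' x''"
    and ode: "\<And>t. t \<ge> t0 \<Longrightarrow>
      x'' t
      + (\<alpha> / t + 2 powr r * (\<alpha> - 1) powr (r - 1) / t powr (2 * r - 1)) *\<^sub>R x' t
      + gradf (x t + (t / (\<alpha> - 1)) *\<^sub>R x' t)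
      + (2 powr r * (\<alpha> - 1) powr r / t powr (2 * r)) *\<^sub>R x t = 0"
  shows "(\<lambda>t. f (x t) - (INF y. f y)) \<in> O[at_top](\<lambda>t. 1 / t powr (\<alpha> - 1) + 1 / t powr (2 * r))
    \<and> (x \<longlongrightarrow> min_norm_element (argmin f)) at_top
    \<and> (\<lambda>t. (norm (gradf (x t)))\<^sup>2) \<in> O[at_top](\<lambda>t. 1 / t powr (\<alpha> - 1) + 1 / t powr (2 * r))"
proof -
  interpret convex_gradient f gradf
    by unfold_locales (fact convex grad nonempty)+
  define a where "a = \<alpha> - 1"
  define c where "c = 2 powr r * a powr r"
  define y where "y t = x t + (t / a) *\<^sub>R x' t" for t
  \<comment> \<open>Beyond \<open>t0\<close> the one-sided derivatives are two-sided; any time after \<open>t0\<close> would do.\<close>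
  define T0 where "T0 = t0 + 1"
  have a: "a > 0" unfolding a_def using \<alpha> by simp
  have x_deriv: "(x has_vector_derivative x' t) (at t)" "(x' has_vector_derivative x'' t) (at t)"
    if "t \<ge> T0" for t
  proof -
    have "t \<in> interior {t0..}" using that unfolding T0_def by simp
    then have "at t within {t0..} = at t" by (rule at_within_interior)
    moreover have "t \<ge> t0" using that unfolding T0_def by simp
    ultimately show "(x has_vector_derivative x' t) (at t)" "(x' has_vector_derivative x'' t) (at t)"
      using C2 unfolding C2_with_derivs_def by metis+
  qed
  \<comment> \<open>The coefficients of the equation are such that \<open>x'' + (\<alpha> / t) *\<^sub>R x'\<close> is \<open>a / t\<close> times the
    derivative of \<open>y\<close>, and the remaining terms in \<open>x\<close> and \<open>x'\<close> add up to a multiple of \<open>y\<close>.\<close>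
  have flow: "(y has_vector_derivative
      - (1 / a * t) *\<^sub>R (gradf (y t) + (c * t powr (- 2 * r)) *\<^sub>R y t)) (at t)"
    if t: "t \<ge> T0" for t
  proof -
    have tpos: "t > 0" "t \<ge> t0" using t t0 unfolding T0_def by auto
    have "(y has_vector_derivative x' t + ((t / a) *\<^sub>R x'' t + (1 / a) *\<^sub>R x' t)) (at t)"
      unfolding y_def
      by (intro has_vector_derivative_add has_vector_derivative_scaleR x_deriv t DERIV_cdivide DERIV_ident)
    moreover have "x' t + ((t / a) *\<^sub>R x'' t + (1 / a) *\<^sub>R x' t) = (t / a) *\<^sub>R (x'' t + (\<alpha> / t) *\<^sub>R x' t)"
    proof -
      have "(t / a) * (\<alpha> / t) = 1 + 1 / a" using tpos a unfolding a_def by (simp add: field_simps)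
      then show ?thesis by (simp add: scaleR_add_right scaleR_add_left)
    qed
    moreover have "x'' t + (\<alpha> / t) *\<^sub>R x' t = - (gradf (y t) + (c * t powr (- 2 * r)) *\<^sub>R y t)"
    proof -
      have "2 powr r * a powr (r - 1) / t powr (2 * r - 1) = c * t powr (- 2 * r) * (t / a)"
        unfolding c_def using tpos a by (simp add: powr_diff powr_minus field_simps)
      moreover have "2 powr r * a powr r / t powr (2 * r) = c * t powr (- 2 * r)"
        unfolding c_def using tpos by (simp add: powr_minus field_simps)
      ultimately have "x'' t + (\<alpha> / t + c * t powr (- 2 * r) * (t / a)) *\<^sub>R x' t + gradf (y t)
          + (c * t powr (- 2 * r)) *\<^sub>R x t = 0"
        using ode[OF tpos(2)] unfolding a_def[symmetric] y_def by simp
      then show ?thesis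
        unfolding eq_neg_iff_add_eq_0 y_def by (simp add: scaleR_add_left scaleR_add_right add_ac)
    qed
    ultimately show ?thesis by (simp add: scaleR_diff_right scaleR_add_right)
  qed
  interpret tikhonov_flow f gradf y "1 / a" c r T0
    by unfold_locales (use a r t0 flow in \<open>auto simp: c_def T0_def\<close>)
  have average: "(x has_vector_derivative (a / t) *\<^sub>R (y t - x t)) (at t)" if "t \<ge> T0" for t
    using x_deriv(1)[OF that] that a T0 unfolding y_def by simp
  let ?rate = "\<lambda>t. 1 / t powr (\<alpha> - 1) + 1 / t powr (2 * r)"
  have rate_nonneg: "0 \<le> ?rate t" for t by simp
  obtain C T where C: "\<And>t. t \<ge> T \<Longrightarrow> f (x t) - fmin \<le> C * ?rate t"
    using averaged_value_rate[OF a average] unfolding a_def by blast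
  have i: "(\<lambda>t. f (x t) - fmin) \<in> O[at_top](?rate)"
    by (rule bigoI[of _ C])
      (use C fmin_le in \<open>auto simp: eventually_at_top_linorder abs_of_nonneg\<close>)
  have ii: "(x \<longlongrightarrow> min_norm_element (argmin f)) at_top"
    by (rule weighted_average_tendsto[OF a T0 average flow_tendsto])
  obtain p where p: "p \<in> argmin f" "p = min_norm_element (argmin f)"
    using argmin_min_norm_element by blast
  \<comment> \<open>The maximum of \<open>L0\<close> with \<open>1\<close> provides a positive constant even when \<open>gradf\<close> is constant on the ball.\<close>
  obtain L0 where "L0-lipschitz_on (cball p 2) gradf" using lipschitz bounded_cball by blast
  then have L: "(max L0 1)-lipschitz_on (cball p 2) gradf"
    by (rule lipschitz_on_le) simp
  have "\<forall>\<^sub>F t in at_top. dist (x t) p < 1"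
    using tendstoD[OF ii, of 1] unfolding p(2) by simp
  then have "\<forall>\<^sub>F t in at_top. norm ((norm (gradf (x t)))\<^sup>2) \<le> 4 * max L0 1 * norm (f (x t) - fmin)"
  proof eventually_elim
    fix t assume "dist (x t) p < 1"
    then have "x t \<in> cball p 1" by (simp add: dist_commute)
    then show "norm ((norm (gradf (x t)))\<^sup>2) \<le> 4 * max L0 1 * norm (f (x t) - fmin)"
      using gradient_square_le[OF p(1) L, of "x t"] fmin_le[of "x t"] by simp
  qed
  then have "(\<lambda>t. (norm (gradf (x t)))\<^sup>2) \<in> O[at_top](\<lambda>t. f (x t) - fmin)"
    by (rule bigoI)
  then have iii: "(\<lambda>t. (norm (gradf (x t)))\<^sup>2) \<in> O[at_top](?rate)"
    using i by (rule landau_o.big_trans)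
  show ?thesis using i ii iii by blast
qed

end
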